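(* Let $n$ and $k$ be positive integers with $k<n$. Then $$\sum_{i=1}^n c(n,i)\cdot i\cdot (-k)^{i-1} = (-1)^k\, k!\,(n-k-1)!.$$
   Context: $c(n,i)$ denotes the number of permutations of $[n]=\{1,2,\ldots,n\}$ with exactly $i$ cycles in their disjoint cycle decomposition, where fixed points count as cycles of length $1$. *)

theory Defs
  imports Complex_Main "HOL-Library.Disjoint_Sets" "HOL-Combinatorics.Orbits"
begin

text \<open>
  A cycle of \<open>p\<close> is represented by the set of points it moves around, that is, by a set on
  which \<open>p\<close> acts cyclically. A fixed point \<open>x\<close> contributes the cycle \<open>{x}\<close> of length 1.
\<close>

definition cycles_on :: "'a set \<Rightarrow> ('a \<Rightarrow> 'a) \<Rightarrow> 'a set set" where
  "cycles_on S p = {C. C \<subseteq> S \<and> cyclic_on p C}"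

lemma cycles_on_eq_orbits:
  assumes "p permutes S" and "finite S"
  shows "cycles_on S p = orbit p ` S"
proof
  show "cycles_on S p \<subseteq> orbit p ` S"
    by (auto simp: cycles_on_def cyclic_on_def)
  have "orbit p x \<subseteq> S" if "x \<in> S" for x
    using permutes_orbit_subset[OF assms(1) that] .
  then show "orbit p ` S \<subseteq> cycles_on S p"
    using cyclic_on_orbit[OF assms] by (auto simp: cycles_on_def)
qed

lemma partition_on_cycles_on:
  assumes "p permutes S" and "finite S"
  shows "partition_on S (cycles_on S p)"
proof (rule partition_onI)
  have "x \<in> orbit p x" for x
    using assms by (metis permutation_permutes permutation_self_in_orbit)
  moreover have "C \<subseteq> S" if "C \<in> cycles_on S p" for C
    using that by (simp add: cycles_on_def)
  ultimately show "\<Union>(cycles_on S p) = S"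
    unfolding cycles_on_eq_orbits[OF assms] by blast
next
  fix C D assume "C \<in> cycles_on S p" "D \<in> cycles_on S p" "C \<noteq> D"
  then show "disjnt C D"
    by (auto simp: cycles_on_def cyclic_on_alldef disjnt_def)
next
  show "{} \<notin> cycles_on S p" by (simp add: cycles_on_def cyclic_on_def)
qed

definition cycle_count :: "nat \<Rightarrow> nat \<Rightarrow> nat" where
  "cycle_count n i = card {p. p permutes {1..n} \<and> card (cycles_on {1..n} p) = i}"

end

theory Submission
  imports Defs "HOL-Computational_Algebra.Polynomial"
begin

text \<open>
  Summing \<open>x\<close> to the number of cycles over all permutations of an \<open>n\<close>-element set gives the
  rising factorial \<open>x (x + 1) \<dots> (x + n - 1)\<close>. Indeed, a permutation of \<open>insert a S\<close> arises in
  exactly one way from a permutation \<open>q\<close> of \<open>S\<close>: either \<open>a\<close> becomes a new fixed point, which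
  contributes a factor \<open>x\<close>, or \<open>a\<close> is placed immediately before one of the \<open>card S\<close> points in
  its cycle of \<open>q\<close>, which leaves the number of cycles unchanged
  (\<open>card_cycles_on_transpose_comp\<close>). So the sum acquires the factor \<open>x + card S\<close>
  (\<open>sum_power_card_cycles_on\<close>).

  For the indeterminate \<open>x = X\<close> this identifies \<open>\<Sum>i. c(n,i) X^i\<close> with the product of the linear
  factors \<open>X + j\<close> for \<open>j < n\<close>. The sum in the theorem is the derivative of that polynomial at
  \<open>-k\<close>. Because \<open>k < n\<close>, the polynomial vanishes there through its factor \<open>X + k\<close>, so the
  derivative is the value at \<open>-k\<close> of the product of the other factors. The factors with \<open>j < k\<close>
  yield \<open>(-1)^k k!\<close> and those with \<open>j > k\<close> yield \<open>(n - k - 1)!\<close>.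
\<close>

text \<open>
  The permutation \<open>p = transpose a b \<circ> q\<close> runs through the points of \<open>S\<close> in the same order as
  \<open>q\<close>, except that it makes a detour through \<open>a\<close> whenever \<open>q\<close> would step to \<open>b\<close>.
\<close>
lemma orbit_transpose_comp:
  assumes q: "q permutes S" and a: "a \<notin> S" and b: "b \<in> S" and x: "x \<in> S"
  shows "orbit (transpose a b \<circ> q) x - {a} = orbit q x"
proof -
  let ?p = "transpose a b \<circ> q"
  have p_a: "?p a = b"
    using permutes_not_in[OF q a] by simp
  have p_S: "?p y = (if q y = b then a else q y)" if "y \<in> S" for y
    using that a permutes_in_image[OF q, of y] by (auto simp: transpose_def)
  have orbit_q: "orbit q x \<subseteq> S"
    by (rule permutes_orbit_subset[OF q x])
  \<comment> \<open>The orbit of \<open>x\<close> under \<open>p\<close> may pass through \<open>a\<close>; there the induction has to record that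
    the next point \<open>b\<close> is in the orbit under \<open>q\<close>.\<close>
  have p_imp_q: "(if y = a then b else y) \<in> orbit q x" if "y \<in> orbit ?p x" for y
    using that
  proof induction
    case base
    then show ?case using p_S[OF x] orbit.base[of q x] permutes_in_image[OF q, of x] x a
      by auto
  next
    case (step y)
    show ?case
    proof (cases "y = a")
      case True
      then show ?thesis using step.IH a b p_a by auto
    next
      case False
      then have "y \<in> orbit q x" using step.IH by simp
      then have "q y \<in> orbit q x" "y \<in> S" using orbit_q by (auto intro: orbit.step)
      then show ?thesis using p_S[of y] orbit_q a by auto
    qed
  qed
  have detour: "q y \<in> orbit ?p y" if "y \<in> S" for y
    using p_S[OF that] p_a orbit.base[of ?p y] orbit.step[OF orbit.base[of ?p y]]
    by (auto split: if_splits)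
  have q_imp_p: "y \<in> orbit ?p x" if "y \<in> orbit q x" for y
    using that
  proof induction
    case base
    show ?case by (rule detour[OF x])
  next
    case (step y)
    then show ?case using detour[of y] orbit_q orbit_trans by fast
  qed
  have "y \<in> orbit q x" if "y \<in> orbit ?p x" "y \<noteq> a" for y
    using p_imp_q[OF that(1)] that(2) by simp
  then show ?thesis
    using q_imp_p orbit_q a by blast
qed

text \<open>
  Removing \<open>a\<close> from the cycle containing it gives a bijection from the cycles of
  \<open>transpose a b \<circ> q\<close> onto those of \<open>q\<close>: no cycle is lost, since the cycle of \<open>a\<close> also
  contains \<open>b\<close>.
\<close>
lemma card_cycles_on_transpose_comp:
  assumes q: "q permutes S" and fin: "finite S" and a: "a \<notin> S" and b: "b \<in> S"
  shows "card (cycles_on (insert a S) (transpose a b \<circ> q)) = card (cycles_on S q)"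
proof -
  let ?p = "transpose a b \<circ> q"
  have p: "?p permutes insert a S"
    using permutes_compose[OF permutes_subset[OF q] permutes_swap_id[of a "insert a S" b]] b
    by auto
  then have perm: "permutation ?p"
    using fin permutation_permutes by blast
  have "?p a = b"
    using permutes_not_in[OF q a] by simp
  then have "orbit ?p a = orbit ?p b"
    using permutation_orbit_step[OF perm, of a] by simp
  then have cycles_p: "cycles_on (insert a S) ?p = orbit ?p ` S"
    using cycles_on_eq_orbits[OF p] fin b by auto
  have "inj_on (\<lambda>C. C - {a}) (orbit ?p ` S)"
  proof (rule inj_onI, clarify)
    fix x y
    assume x: "x \<in> S" and y: "y \<in> S" and eq: "orbit ?p x - {a} = orbit ?p y - {a}"
    have "x \<in> orbit ?p x" by (rule permutation_self_in_orbit[OF perm])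
    then have "x \<in> orbit ?p y" using eq x a by auto
    then show "orbit ?p x = orbit ?p y"
      using cyclic_on_orbit'[OF perm, of y] orbit_cyclic_eq3 by metis
  qed
  then have "card (orbit ?p ` S) = card ((\<lambda>C. C - {a}) ` orbit ?p ` S)"
    by (simp add: card_image)
  also have "(\<lambda>C. C - {a}) ` orbit ?p ` S = orbit q ` S"
    unfolding image_image using orbit_transpose_comp[OF q a b] by (intro image_cong) auto
  finally show ?thesis
    by (simp only: cycles_p cycles_on_eq_orbits[OF q fin])
qed

lemma card_cycles_on_new_fixpoint:
  assumes q: "q permutes S" and fin: "finite S" and a: "a \<notin> S"
  shows "card (cycles_on (insert a S) q) = Suc (card (cycles_on S q))"
proof -
  have q': "q permutes insert a S"
    using q by (rule permutes_subset) auto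
  have "orbit q a = {a}"
    using permutes_not_in[OF q a] by (simp add: orbit_eq_singleton_iff)
  moreover have "{a} \<notin> orbit q ` S"
    using permutes_orbit_subset[OF q] a by blast
  ultimately show ?thesis
    using cycles_on_eq_orbits[OF q'] cycles_on_eq_orbits[OF q fin] fin by simp
qed

lemma sum_power_card_cycles_on:
  fixes x :: "'a :: comm_semiring_1"
  assumes "finite S"
  shows "(\<Sum>p | p permutes S. x ^ card (cycles_on S p)) = pochhammer x (card S)"
  using assms
proof (induction S)
  case empty
  have "cycles_on {} p = {}" for p :: "'b \<Rightarrow> 'b"
    by (auto simp: cycles_on_def cyclic_on_def)
  then show ?case by simp
next
  case (insert a S)
  let ?w = "\<lambda>S p. x ^ card (cycles_on S p)"
  have "(\<Sum>p | p permutes insert a S. ?w (insert a S) p)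
      = (\<Sum>b\<in>insert a S. \<Sum>q | q permutes S. ?w (insert a S) (transpose a b \<circ> q))"
    by (rule sum_over_permutations_insert[OF insert.hyps])
  also have "\<dots> = (\<Sum>b\<in>insert a S. \<Sum>q | q permutes S. (if b = a then x else 1) * ?w S q)"
    using insert.hyps
    by (intro sum.cong refl)
       (auto simp: card_cycles_on_transpose_comp card_cycles_on_new_fixpoint)
  also have "\<dots> = (\<Sum>b\<in>insert a S. if b = a then x else 1) * pochhammer x (card S)"
    by (simp add: insert.IH flip: sum_distrib_left sum_distrib_right)
  also have "(\<Sum>b\<in>insert a S. if b = a then x else 1) = x + of_nat (card S)"
  proof -
    have "(\<Sum>b\<in>S. if b = a then x else 1) = (\<Sum>b\<in>S. 1)"
      using insert.hyps by (intro sum.cong) auto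
    then show ?thesis using insert.hyps by simp
  qed
  finally show ?case
    using insert.hyps by (simp add: pochhammer_Suc mult.commute)
qed

lemma card_cycles_on_le:
  assumes "p permutes S" and "finite S"
  shows "card (cycles_on S p) \<le> card S"
  using assms by (simp add: cycles_on_eq_orbits card_image_le)

lemma sum_cycle_count_power:
  fixes x :: "'a :: comm_semiring_1"
  shows "(\<Sum>i\<le>n. of_nat (cycle_count n i) * x ^ i) = pochhammer x n"
proof -
  let ?P = "{p. p permutes {1..n}}"
  let ?c = "\<lambda>p. card (cycles_on {1..n} p)"
  have "of_nat (cycle_count n i) * x ^ i = (\<Sum>p\<in>{p \<in> ?P. ?c p = i}. x ^ ?c p)" for i
    by (simp add: cycle_count_def)
  then have "(\<Sum>i\<le>n. of_nat (cycle_count n i) * x ^ i)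
      = (\<Sum>i\<le>n. \<Sum>p\<in>{p \<in> ?P. ?c p = i}. x ^ ?c p)"
    by simp
  also have "\<dots> = (\<Sum>p\<in>?P. x ^ ?c p)"
    using card_cycles_on_le[of _ "{1..n}"] by (intro sum.group) (auto simp: finite_permutations)
  also have "\<dots> = pochhammer x n"
    by (simp add: sum_power_card_cycles_on)
  finally show ?thesis .
qed

lemma prod_shift_omit:
  fixes n k :: nat
  assumes "k < n"
  shows "(\<Prod>j\<in>{..<n} - {k}. int j - int k) = (- 1) ^ k * fact k * fact (n - k - 1)"
proof -
  have split: "{..<n} - {k} = {..<k} \<union> {Suc k..<n}"
    using assms by auto
  have "(\<Prod>j<k. int j - int k) = (\<Prod>j<k. - int (Suc j))"
    by (rule prod.reindex_bij_witness[of _ "\<lambda>j. k - Suc j" "\<lambda>j. k - Suc j"]) auto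
  also have "\<dots> = (- 1) ^ k * fact k"
    using prod.distrib[of "\<lambda>_. - 1" "\<lambda>j. int (Suc j)" "{..<k}"]
    by (simp only: fact_prod_Suc of_nat_prod lessThan_atLeast0) simp
  finally have below: "(\<Prod>j<k. int j - int k) = (- 1) ^ k * fact k" .
  have "(\<Prod>j\<in>{Suc k..<n}. int j - int k) = (\<Prod>j\<in>{0..<n - k - 1}. int (Suc j))"
    by (rule prod.reindex_bij_witness[of _ "\<lambda>j. j + Suc k" "\<lambda>j. j - Suc k"]) auto
  also have "\<dots> = fact (n - k - 1)"
    unfolding fact_prod_Suc by simp
  finally have above: "(\<Prod>j\<in>{Suc k..<n}. int j - int k) = fact (n - k - 1)" .
  show ?thesis
    unfolding split by (subst prod.union_disjoint) (auto simp: below above)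
qed

theorem mainTheorem2:
  fixes n k :: nat
  assumes "0 < n" and "0 < k" and "k < n"
  shows "(\<Sum>i = 1..n. int (cycle_count n i) * int i * (- int k) ^ (i - 1))
       = (- 1) ^ k * fact k * fact (n - k - 1)"
proof -
  define P :: "int poly" where "P = (\<Sum>i\<le>n. of_nat (cycle_count n i) * monom 1 1 ^ i)"
  define Q :: "int poly" where "Q = (\<Prod>j\<in>{..<n} - {k}. [:int j, 1:])"
  have "poly (pderiv P) (- int k)
      = (\<Sum>i\<le>n. int (cycle_count n i) * int i * (- int k) ^ (i - 1))"
    by (simp add: P_def monom_power higher_pderiv_sum[where n = 1, simplified] pderiv_mult pderiv_monom poly_sum poly_monom
        pderiv_of_nat mult.assoc)
  also have "\<dots> = (\<Sum>i = 1..n. int (cycle_count n i) * int i * (- int k) ^ (i - 1))"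
    by (rule sum.mono_neutral_right) auto
  finally have lhs: "(\<Sum>i = 1..n. int (cycle_count n i) * int i * (- int k) ^ (i - 1))
      = poly (pderiv P) (- int k)" ..
  have "P = (\<Prod>j<n. [:int j, 1:])"
    unfolding P_def sum_cycle_count_power pochhammer_prod lessThan_atLeast0
    by (simp add: monom_altdef of_nat_poly)
  also have "\<dots> = [:int k, 1:] * Q"
    unfolding Q_def using assms(3) by (intro prod.remove) auto
  finally have "P = [:int k, 1:] * Q" .
  then have "poly (pderiv P) (- int k) = poly Q (- int k)"
    by (simp only: pderiv_mult) (simp add: pderiv_pCons)
  also have "\<dots> = (\<Prod>j\<in>{..<n} - {k}. int j - int k)"
    by (simp add: Q_def poly_prod)
  finally show ?thesis
    using lhs prod_shift_omit[OF assms(3)] by simp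
qed

end
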